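(* Let $n\ge 1$ and let $U,V\subset\mathbb{R}^n$ be $0$-symmetric closed convex bodies. Put $H:=\tfrac12 U$ and $K:=V+H$. Let $X\subset\mathbb{R}^n$ be a finite set of points such that $K\subseteq H+X$. Then $$C_n(U,V)\le \frac{|X|\,|U|}{|V|}.$$
   Context: A convex body is a compact convex set with nonempty interior; it is $0$-symmetric if $A=-A$. $A+B$ denotes the Minkowski sum and $\lambda A=\{\lambda a: a\in A\}$. $|A|$ denotes the volume (Lebesgue measure) of $A$, or the cardinality of $A$ if $A$ is a finite set. A continuous function $f:\mathbb{R}^n\to\mathbb{C}$ is positive definite if for every finite $Y\subset\mathbb{R}^n$ and all complex numbers $\{c_a: a\in Y\}$ one has $\sum_{a,b\in Y}c_a\overline{c_b}f(a-b)\ge 0$. A double positive definite function, written $f\succeq 0$, is a continuous positive definite function $f$ on $\mathbb{R}^n$ with values in $\mathbb{R}_+=[0,\infty)$. For $0$-symmetric closed convex bodies $U,V\subset\mathbb{R}^n$, $$C_n(U,V):=\sup_{f\succeq 0,\ f\ne 0}\frac{\frac{1}{|V|}\int_V f(x)\,dx}{\frac{1}{|U|}\int_U f(x)\,dx}.$$ *)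

theory Defs
  imports "HOL-Analysis.Analysis"
begin

definition convex_body :: "(real ^ 'n) set \<Rightarrow> bool" where
  "convex_body A \<longleftrightarrow> compact A \<and> convex A \<and> interior A \<noteq> {}"

definition zero_symmetric :: "(real ^ 'n) set \<Rightarrow> bool" where
  "zero_symmetric A \<longleftrightarrow> A = uminus ` A"

definition positive_definite :: "(real ^ 'n \<Rightarrow> complex) \<Rightarrow> bool" where
  "positive_definite f \<longleftrightarrow> continuous_on UNIV f \<and>
     (\<forall>(Y :: (real ^ 'n) set) (c :: real ^ 'n \<Rightarrow> complex). finite Y \<longrightarrow>
        (\<Sum>a\<in>Y. \<Sum>b\<in>Y. c a * cnj (c b) * f (a - b)) \<in> \<real>\<^sub>\<ge>\<^sub>0)"

definition double_positive_definite :: "(real ^ 'n \<Rightarrow> real) \<Rightarrow> bool" where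
  "double_positive_definite f \<longleftrightarrow>
     positive_definite (\<lambda>x. complex_of_real (f x)) \<and> (\<forall>x. 0 \<le> f x)"

definition average :: "(real ^ 'n) set \<Rightarrow> (real ^ 'n \<Rightarrow> real) \<Rightarrow> real" where
  "average A f = 1 / measure lebesgue A * (LINT x:A|lebesgue. f x)"

(* The supremum is taken in the extended reals, so it is the true one even if the quotients are
   unbounded. For a 0-symmetric convex body U and an admissible f the denominator is positive,
   since f is continuous, f 0 > 0 and 0 is an interior point of U. *)
definition C_const :: "(real ^ 'n) set \<Rightarrow> (real ^ 'n) set \<Rightarrow> ereal" where
  "C_const U V =
     (SUP f \<in> {f. double_positive_definite f \<and> f \<noteq> (\<lambda>x. 0)}. ereal (average V f / average U f))"

end

theory Submission
  imports Defs
begin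

text \<open>
  The quotient of averages is bounded as soon as every double positive definite \<open>f\<close> satisfies
  \<open>\<integral>\<^sub>V f \<le> |X| \<integral>\<^sub>U f\<close>.  To see this, compare the shifted double integrals
  \<open>J(t) = \<integral>\<^sub>H \<integral>\<^sub>H f(x - y + t) dx dy\<close>, which are the values of the positive semidefinite form
  \<open>\<langle>g, h\<rangle> = \<integral>\<integral> g(x) h(y) f(x - y) dx dy\<close> on the indicators of a translate of \<open>H\<close> and of \<open>H\<close>.

  \<^item> The form is translation invariant, so Cauchy--Schwarz gives \<open>J(t) \<le> J(0)\<close>
    (\<open>pos_def_real_shifted_double_integral_le\<close>).
  \<^item> If \<open>y \<in> H\<close>, then \<open>V + y \<subseteq> K\<close> is covered by the translates \<open>H + z\<close> with \<open>z \<in> X\<close>.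
    Since \<open>f \<ge> 0\<close>, this gives \<open>\<integral>\<^sub>V f \<le> \<Sum>\<^sub>z \<integral>\<^sub>H f(x - y + z) dx\<close>, and integration over \<open>y \<in> H\<close>
    gives \<open>|H| \<integral>\<^sub>V f \<le> \<Sum>\<^sub>z J(z)\<close>.
  \<^item> If \<open>y \<in> H\<close>, then \<open>H - y \<subseteq> H - H = U\<close>, so \<open>J(0) \<le> |H| \<integral>\<^sub>U f\<close>.

  Together these say \<open>|H| \<integral>\<^sub>V f \<le> |X| |H| \<integral>\<^sub>U f\<close> (\<open>pos_def_real_integral_le_covering\<close>), and \<open>|H| > 0\<close>
  cancels.  The passage from finite sums to integrals, which makes the form semidefinite, is
  \<open>pos_def_real_double_integral_nonneg\<close>.
\<close>

section \<open>Real positive definite functions\<close>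

text \<open>
  Only real coefficients are tested, so that the whole argument stays within the reals.  Complex
  coefficients would in addition force a real-valued function to be even; evenness is therefore
  a separate hypothesis where it matters.
\<close>
definition pos_def_real :: "('a::ab_group_add \<Rightarrow> real) \<Rightarrow> bool" where
  "pos_def_real f \<longleftrightarrow>
     (\<forall>Y c. finite Y \<longrightarrow> 0 \<le> (\<Sum>a\<in>Y. \<Sum>b\<in>Y. c a * c b * f (a - b)))"

lemma pos_def_realD:
  "pos_def_real f \<Longrightarrow> finite Y \<Longrightarrow> 0 \<le> (\<Sum>a\<in>Y. \<Sum>b\<in>Y. c a * c b * f (a - b))"
  unfolding pos_def_real_def by simp

text \<open>
  Points of a family may coincide; adding the coefficients of equal points reduces the double
  sum to one over a set.
\<close>
lemma pos_def_real_family: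
  fixes c :: "'i \<Rightarrow> real"
  assumes "pos_def_real f" and "finite I"
  shows "0 \<le> (\<Sum>i\<in>I. \<Sum>j\<in>I. c i * c j * f (p i - p j))"
proof -
  let ?C = "\<lambda>a. \<Sum>i\<in>{i\<in>I. p i = a}. c i"
  have "(\<Sum>i\<in>I. \<Sum>j\<in>I. c i * c j * f (p i - p j))
      = (\<Sum>a\<in>p`I. \<Sum>i\<in>{i\<in>I. p i = a}. \<Sum>b\<in>p`I. \<Sum>j\<in>{j\<in>I. p j = b}. c i * c j * f (p i - p j))"
    unfolding sum.image_gen[OF assms(2), where g = p and h = "\<lambda>j. c i * c j * f (p i - p j)" for i, symmetric]
    by (rule sum.image_gen[OF assms(2)])
  also have "\<dots> = (\<Sum>a\<in>p`I. \<Sum>b\<in>p`I. \<Sum>i\<in>{i\<in>I. p i = a}. \<Sum>j\<in>{j\<in>I. p j = b}. c i * c j * f (a - b))"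
    by (intro sum.cong refl) (subst sum.swap, intro sum.cong refl, auto)
  also have "\<dots> = (\<Sum>a\<in>p`I. \<Sum>b\<in>p`I. ?C a * ?C b * f (a - b))"
    unfolding sum_product by (simp add: sum_distrib_right)
  also have "\<dots> \<ge> 0"
    by (rule pos_def_realD) (use assms in auto)
  finally show ?thesis .
qed

text \<open>
  The quadratic form of this function at weights \<open>c\<close> on \<open>Y\<close> is the quadratic form of \<open>f\<close> at the
  weights \<open>c\<close> on \<open>Y\<close> and \<open>- c\<close> on \<open>Y + t\<close>.  These two sets may overlap, so the points are
  indexed by \<open>Y \<times> bool\<close>, with \<open>True\<close> marking the shifted copies.
\<close>
lemma pos_def_real_second_difference:
  assumes "pos_def_real f"
  shows "pos_def_real (\<lambda>z. 2 * f z - f (z + t) - f (z - t))"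
  unfolding pos_def_real_def
proof (intro allI impI)
  fix Y :: "'a set" and c :: "'a \<Rightarrow> real"
  assume fin: "finite Y"
  let ?p = "\<lambda>(a, s). if s then a + t else a"
  let ?c = "\<lambda>(a, s). if s then - c a else c a"
  have split: "(\<Sum>i\<in>Y \<times> UNIV. g i) = (\<Sum>a\<in>Y. g (a, False) + g (a, True))" for g :: "'a \<times> bool \<Rightarrow> real"
    by (simp add: sum.cartesian_product' UNIV_bool)
  have "0 \<le> (\<Sum>i\<in>Y \<times> (UNIV::bool set). \<Sum>j\<in>Y \<times> (UNIV::bool set). ?c i * ?c j * f (?p i - ?p j))"
    by (rule pos_def_real_family[OF assms]) (use fin in simp)
  also have "\<dots> = (\<Sum>a\<in>Y. \<Sum>b\<in>Y. c a * c b * (2 * f (a - b) - f (a - b + t) - f (a - b - t)))"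
    by (simp add: split sum.distrib[symmetric]) (simp add: algebra_simps)
  finally show "0 \<le> (\<Sum>a\<in>Y. \<Sum>b\<in>Y. c a * c b * (2 * f (a - b) - f (a - b + t) - f (a - b - t)))" .
qed

section \<open>Double positive definite functions\<close>

lemma positive_definiteD:
  "positive_definite f \<Longrightarrow> finite Y \<Longrightarrow>
     (\<Sum>a\<in>Y. \<Sum>b\<in>Y. c a * cnj (c b) * f (a - b)) \<in> \<real>\<^sub>\<ge>\<^sub>0"
  unfolding positive_definite_def by simp

lemma double_positive_definite_imp_pos_def_real:
  assumes "double_positive_definite f"
  shows "pos_def_real f"
  unfolding pos_def_real_def
proof (intro allI impI)
  fix Y :: "(real ^ 'a) set" and c :: "real ^ 'a \<Rightarrow> real"
  assume "finite Y"
  then have "(\<Sum>a\<in>Y. \<Sum>b\<in>Y. complex_of_real (c a) * cnj (complex_of_real (c b)) * complex_of_real (f (a - b))) \<in> \<real>\<^sub>\<ge>\<^sub>0"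
    using assms by (intro positive_definiteD) (simp_all add: double_positive_definite_def)
  moreover have "(\<Sum>a\<in>Y. \<Sum>b\<in>Y. complex_of_real (c a) * cnj (complex_of_real (c b)) * complex_of_real (f (a - b)))
     = complex_of_real (\<Sum>a\<in>Y. \<Sum>b\<in>Y. c a * c b * f (a - b))" by simp
  ultimately show "0 \<le> (\<Sum>a\<in>Y. \<Sum>b\<in>Y. c a * c b * f (a - b))"
    by (simp only: nonneg_Reals_of_real_iff)
qed

text \<open>
  At the points \<open>0\<close> and \<open>x\<close> with weights \<open>1\<close> and \<open>\<i>\<close>, the quadratic form has imaginary part
  \<open>f x - f (- x)\<close>, and it must be real.
\<close>
lemma double_positive_definite_even:
  fixes f :: "real ^ 'n \<Rightarrow> real"
  assumes "double_positive_definite f"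
  shows "f (- x) = f x"
proof (cases "x = 0")
  case False
  have "(\<Sum>a\<in>{0, x}. \<Sum>b\<in>{0, x}. (if a = 0 then 1 else \<i>) * cnj (if b = 0 then 1 else \<i>)
         * complex_of_real (f (a - b))) \<in> \<real>\<^sub>\<ge>\<^sub>0"
    using assms by (intro positive_definiteD) (simp_all add: double_positive_definite_def)
  then show ?thesis
    using False by (auto simp: complex_nonneg_Reals_iff)
qed simp

text \<open>
  At the points \<open>0\<close> and \<open>x\<close> with weights \<open>1\<close> and \<open>- 1\<close>, the quadratic form is
  \<open>2 f 0 - f x - f (- x) = 2 (f 0 - f x)\<close>.
\<close>
lemma double_positive_definite_le_at_0:
  fixes f :: "real ^ 'n \<Rightarrow> real"
  assumes "double_positive_definite f"
  shows "f x \<le> f 0"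
proof (cases "x = 0")
  case False
  have "0 \<le> (\<Sum>a\<in>{0, x}. \<Sum>b\<in>{0, x}. (if a = 0 then 1 else -1) * (if b = 0 then 1 else -1) * f (a - b))"
    by (rule pos_def_realD[OF double_positive_definite_imp_pos_def_real[OF assms]]) simp
  then show ?thesis
    using False double_positive_definite_even[OF assms, of x] by auto
qed simp

section \<open>Double integrals of positive definite functions\<close>

text \<open>
  Approximate the identity by simple functions \<open>s k\<close>.  With \<open>s k\<close> in both arguments the double
  integral is a finite quadratic form of \<open>F\<close>, whose weights are the measures of the level sets
  of \<open>s k\<close>.  Dominated convergence, with the constant bound \<open>B\<close>, gives the limit.
\<close>
lemma pos_def_real_double_integral_nonneg:
  fixes F :: "'a::euclidean_space \<Rightarrow> real"
  assumes pd: "pos_def_real F" and cont: "continuous_on UNIV F" and bnd: "\<And>x. \<bar>F x\<bar> \<le> B"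
    and "finite_measure M" and sets_M[measurable_cong]: "sets M = sets borel"
  shows "0 \<le> (\<integral>(x, y). F (x - y) \<partial>(M \<Otimes>\<^sub>M M))"
proof -
  interpret M: finite_measure M by fact
  interpret P: finite_measure "M \<Otimes>\<^sub>M M"
    by (rule finite_measure_pair_measure) fact+
  have F_meas[measurable]: "F \<in> borel_measurable borel"
    using cont by (rule borel_measurable_continuous_onI)
  have space_M: "space M = UNIV"
    using sets_eq_imp_space_eq[OF sets_M] by simp
  have "(\<lambda>x::'a. x) \<in> borel_measurable M" by simp
  from borel_measurable_implies_sequence_metric[OF this]
  obtain s where s: "\<And>k. simple_function M (s k)" and lim: "\<And>x. (\<lambda>k. s k x) \<longlonglongrightarrow> x"
    unfolding space_M by blast
  have s_meas[measurable]: "s k \<in> borel_measurable M" for k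
    using s by (rule borel_measurable_simple_function)
  have nonneg: "0 \<le> (\<integral>z. F (s k (fst z) - s k (snd z)) \<partial>(M \<Otimes>\<^sub>M M))" for k
  proof -
    let ?A = "range (s k)" and ?Q = "\<lambda>a. s k -` {a}"
    have fin: "finite ?A" using simple_functionD(1)[OF s[of k]] by (simp add: space_M)
    have Q[measurable]: "?Q a \<in> sets M" for a
      using simple_functionD(2)[OF s[of k], of "{a}"] by (simp add: space_M)
    have "F (s k (fst z) - s k (snd z))
        = (\<Sum>a\<in>?A. \<Sum>b\<in>?A. F (a - b) * indicat_real (?Q a \<times> ?Q b) z)" for z
    proof -
      have "(\<Sum>a\<in>?A. \<Sum>b\<in>?A. F (a - b) * indicat_real (?Q a \<times> ?Q b) z)
          = (\<Sum>a\<in>?A. if s k (fst z) = a then (\<Sum>b\<in>?A. if s k (snd z) = b then F (a - b) else 0) else 0)"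
        by (intro sum.cong refl)
          (auto simp: indicator_def mem_Times_iff intro!: sum.cong)
      also have "\<dots> = F (s k (fst z) - s k (snd z))"
        using fin by simp
      finally show ?thesis ..
    qed
    then have "(\<integral>z. F (s k (fst z) - s k (snd z)) \<partial>(M \<Otimes>\<^sub>M M))
        = (\<integral>z. (\<Sum>a\<in>?A. \<Sum>b\<in>?A. F (a - b) * indicat_real (?Q a \<times> ?Q b) z) \<partial>(M \<Otimes>\<^sub>M M))"
      by simp
    also have "\<dots> = (\<Sum>a\<in>?A. \<Sum>b\<in>?A. F (a - b) * measure (M \<Otimes>\<^sub>M M) (?Q a \<times> ?Q b))"
      by (subst Bochner_Integration.integral_sum, simp_all add: P.emeasure_eq_measure
           Bochner_Integration.integral_sum)
    also have "\<dots> = (\<Sum>a\<in>?A. \<Sum>b\<in>?A. measure M (?Q a) * measure M (?Q b) * F (a - b))"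
      by (simp add: measure_def M.emeasure_pair_measure_Times enn2real_mult mult_ac)
    also have "\<dots> \<ge> 0"
      by (rule pos_def_realD[OF pd fin])
    finally show ?thesis .
  qed
  have "(\<lambda>k. \<integral>z. F (s k (fst z) - s k (snd z)) \<partial>(M \<Otimes>\<^sub>M M))
      \<longlonglongrightarrow> (\<integral>z. F (fst z - snd z) \<partial>(M \<Otimes>\<^sub>M M))"
  proof (rule integral_dominated_convergence[where w = "\<lambda>_. B"])
    show "AE z in M \<Otimes>\<^sub>M M. (\<lambda>k. F (s k (fst z) - s k (snd z))) \<longlonglongrightarrow> F (fst z - snd z)"
      by (intro AE_I2 continuous_on_tendsto_compose[OF cont] tendsto_diff lim) auto
  qed (use bnd in \<open>auto\<close>)
  then have "0 \<le> (\<integral>z. F (fst z - snd z) \<partial>(M \<Otimes>\<^sub>M M))"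
    by (rule LIMSEQ_le_const) (use nonneg in auto)
  then show ?thesis by (simp add: case_prod_beta')
qed

text \<open>
  This is the Cauchy--Schwarz inequality for \<open>M\<close> and its translate by \<open>t\<close>, which have the same
  energy.  It follows by integrating the second difference of \<open>f\<close>: the integrals with shifts
  \<open>t\<close> and \<open>- t\<close> agree, because evenness of \<open>f\<close> turns one into the other when the variables
  are exchanged.
\<close>
lemma pos_def_real_shifted_double_integral_le:
  fixes f :: "'a::euclidean_space \<Rightarrow> real"
  assumes pd: "pos_def_real f" and cont: "continuous_on UNIV f" and bnd: "\<And>x. \<bar>f x\<bar> \<le> B"
    and even: "\<And>x. f (- x) = f x"
    and "finite_measure M" and sets_M[measurable_cong]: "sets M = sets borel"
  shows "(\<integral>(x, y). f (x - y + t) \<partial>(M \<Otimes>\<^sub>M M)) \<le> (\<integral>(x, y). f (x - y) \<partial>(M \<Otimes>\<^sub>M M))"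
proof -
  interpret M: finite_measure M by fact
  interpret P: finite_measure "M \<Otimes>\<^sub>M M"
    by (rule finite_measure_pair_measure) fact+
  interpret PS: pair_sigma_finite M M ..
  have f_meas[measurable]: "f \<in> borel_measurable borel"
    using cont by (rule borel_measurable_continuous_onI)
  have int: "integrable (M \<Otimes>\<^sub>M M) (\<lambda>z. f (fst z - snd z + u))" for u
    by (rule P.integrable_const_bound[where B = B]) (use bnd in auto)
  let ?J = "\<lambda>u. \<integral>z. f (fst z - snd z + u) \<partial>(M \<Otimes>\<^sub>M M)"
  have "?J (- t) = (\<integral>(x, y). f (x - y - t) \<partial>(M \<Otimes>\<^sub>M M))"
    by (simp add: case_prod_beta')
  also have "\<dots> = (\<integral>(x, y). f (y - x - t) \<partial>(M \<Otimes>\<^sub>M M))"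
    by (subst PS.integral_product_swap[symmetric]) (auto simp: case_prod_beta')
  also have "\<dots> = ?J t"
  proof -
    have "f (y - x - t) = f (x - y + t)" for x y
      using even[of "x - y + t"] by (simp add: algebra_simps)
    then show ?thesis by (simp add: case_prod_beta')
  qed
  finally have sym: "?J (- t) = ?J t" .
  have "0 \<le> (\<integral>(x, y). 2 * f (x - y) - f (x - y + t) - f (x - y - t) \<partial>(M \<Otimes>\<^sub>M M))"
  proof (rule pos_def_real_double_integral_nonneg[OF pos_def_real_second_difference[OF pd]])
    show "continuous_on UNIV (\<lambda>z. 2 * f z - f (z + t) - f (z - t))"
      by (intro continuous_intros continuous_on_compose2[OF cont]) auto
    show "\<bar>2 * f z - f (z + t) - f (z - t)\<bar> \<le> 4 * B" for z
      using bnd[of z] bnd[of "z + t"] bnd[of "z - t"] by linarith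
  qed fact+
  also have "\<dots> = 2 * ?J 0 - ?J t - ?J (- t)"
    using int[of 0] int[of t] int[of "- t"] by (simp add: case_prod_beta')
  finally show ?thesis
    using sym by (simp add: case_prod_beta')
qed

section \<open>Comparison of integrals through a covering\<close>

text \<open>
  The sum over \<open>z \<in> X\<close> of the shifted double integrals over \<open>H \<times> H\<close> is at least \<open>|H| \<integral>\<^sub>V f\<close> by
  the covering, and at most \<open>|X|\<close> times the unshifted one, which \<open>H - H \<subseteq> U\<close> bounds by
  \<open>|H| \<integral>\<^sub>U f\<close>.
\<close>
lemma pos_def_real_integral_le_covering:
  fixes f :: "'a::euclidean_space \<Rightarrow> real"
  assumes pd: "pos_def_real f" and cont: "continuous_on UNIV f" and bnd: "\<And>x. f x \<le> B"
    and even: "\<And>x. f (- x) = f x" and nonneg: "\<And>x. 0 \<le> f x"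
    and H: "compact H" "0 < measure lborel H" and U: "compact U" and V: "compact V"
    and diff: "\<And>x y. x \<in> H \<Longrightarrow> y \<in> H \<Longrightarrow> x - y \<in> U"
    and cover: "\<And>u y. u \<in> V \<Longrightarrow> y \<in> H \<Longrightarrow> \<exists>z\<in>X. u + y - z \<in> H" and fin: "finite X"
  shows "(\<integral>x\<in>V. f x \<partial>lborel) \<le> real (card X) * (\<integral>x\<in>U. f x \<partial>lborel)"
proof -
  have [measurable]: "H \<in> sets borel" "U \<in> sets borel" "V \<in> sets borel"
    using H U V by (auto intro: borel_compact)
  have f_meas[measurable]: "f \<in> borel_measurable borel"
    using cont by (rule borel_measurable_continuous_onI)
  have absb: "\<bar>f x\<bar> \<le> B" for x using bnd nonneg by (simp add: abs_of_nonneg)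
  define M where "M = density lborel (indicat_real H)"
  have sets_M[measurable_cong]: "sets M = sets borel" by (simp add: M_def)
  have em: "emeasure M UNIV = emeasure lborel H"
    by (simp add: M_def emeasure_density ennreal_indicator)
  have fin_H: "emeasure lborel H < \<infinity>"
    using H emeasure_compact_finite by blast
  have finM: "finite_measure M"
    by (rule finite_measureI) (use em fin_H in \<open>simp add: M_def\<close>)
  interpret M: finite_measure M by fact
  interpret P: finite_measure "M \<Otimes>\<^sub>M M"
    by (rule finite_measure_pair_measure) fact+
  interpret PS: pair_sigma_finite M M ..
  let ?J = "\<lambda>t. \<integral>(x, y). f (x - y + t) \<partial>(M \<Otimes>\<^sub>M M)"
  let ?g = "\<lambda>t y. \<integral>x. f (x - y + t) \<partial>M"
  have int: "integrable (M \<Otimes>\<^sub>M M) (\<lambda>(x, y). f (x - y + t))" for t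
    by (rule P.integrable_const_bound[where B = B]) (use absb in auto)
  have J: "?J t = (\<integral>y. ?g t y \<partial>M)" for t
    using PS.integral_snd[OF int[of t]] by simp
  have int_g: "integrable M (?g t)" for t
    using PS.integrable_snd[OF int[of t]] by simp
  have ind_int: "integrable lborel (\<lambda>u. indicat_real A u * f u)" if "compact A" for A
    using borel_integrable_compact[OF that continuous_on_subset[OF cont]]
    by (simp add: indicator_def if_distrib cong: if_cong)
  have int_sh: "integrable lborel (\<lambda>u. indicat_real H (u + w) * f u)" for w
  proof -
    have "compact ((\<lambda>x. x - w) ` H)"
      using H by (intro compact_continuous_image continuous_intros) auto
    from ind_int[OF this] show ?thesis
      by (rule back_subst[where P = "integrable lborel"])
        (auto simp: indicator_def image_iff fun_eq_iff algebra_simps)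
  qed
  \<comment> \<open>The substitution \<open>u = x - y + t\<close> fixes the argument of \<open>f\<close> and moves the dependence on
      \<open>y\<close> and \<open>t\<close> into the region of integration.\<close>
  have g: "?g t y = (\<integral>u. indicat_real H (u + (y - t)) * f u \<partial>lborel)" for t y
  proof -
    have "?g t y = (\<integral>x. indicat_real H x * f (x - y + t) \<partial>lborel)"
      by (simp add: M_def integral_density)
    also have "\<dots> = (\<integral>x. indicat_real H x * f (x - y + t) \<partial>distr lborel borel ((+) (y - t)))"
      by (simp add: lborel_distr_plus)
    also have "\<dots> = (\<integral>u. indicat_real H (u + (y - t)) * f u \<partial>lborel)"
      by (subst integral_distr) (auto simp: algebra_simps)
    finally show ?thesis .
  qed
  have AE_H: "AE y in M. y \<in> H"
    unfolding M_def by (subst AE_density) (auto simp: indicator_def)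
  have mM: "measure M (space M) = measure lborel H"
    using em by (simp add: measure_def M_def)
  let ?IV = "\<integral>x\<in>V. f x \<partial>lborel" and ?IU = "\<integral>x\<in>U. f x \<partial>lborel"
  have lower: "?IV \<le> (\<Sum>z\<in>X. ?g z y)" if y: "y \<in> H" for y
  proof -
    have "?IV = (\<integral>u. indicat_real V u * f u \<partial>lborel)"
      by (simp add: set_lebesgue_integral_def)
    also have "\<dots> \<le> (\<integral>u. (\<Sum>z\<in>X. indicat_real H (u + (y - z)) * f u) \<partial>lborel)"
    proof (rule integral_mono)
      fix u
      show "indicat_real V u * f u \<le> (\<Sum>z\<in>X. indicat_real H (u + (y - z)) * f u)"
      proof (cases "u \<in> V")
        case True
        then obtain z where z: "z \<in> X" "u + (y - z) \<in> H"
          using cover[OF True y] by (auto simp: algebra_simps)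
        have "f u = indicat_real H (u + (y - z)) * f u" using z by simp
        also have "\<dots> \<le> (\<Sum>z\<in>X. indicat_real H (u + (y - z)) * f u)"
          by (rule member_le_sum[OF z(1)]) (use fin nonneg in auto)
        finally show ?thesis using True by simp
      qed (auto intro!: sum_nonneg mult_nonneg_nonneg nonneg)
    qed (use ind_int[OF V] int_sh in auto)
    also have "\<dots> = (\<Sum>z\<in>X. ?g z y)"
      by (subst Bochner_Integration.integral_sum) (use int_sh g in auto)
    finally show ?thesis .
  qed
  have upper: "?g 0 y \<le> ?IU" if y: "y \<in> H" for y
  proof -
    have "?g 0 y = (\<integral>u. indicat_real H (u + (y - 0)) * f u \<partial>lborel)" by (rule g)
    also have "\<dots> \<le> (\<integral>u. indicat_real U u * f u \<partial>lborel)"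
    proof (rule integral_mono)
      show "indicat_real H (u + (y - 0)) * f u \<le> indicat_real U u * f u" for u
        using diff[of "u + y" y] y nonneg[of u] by (auto simp: indicator_def)
    qed (use ind_int[OF U] int_sh in auto)
    also have "\<dots> = ?IU" by (simp add: set_lebesgue_integral_def)
    finally show ?thesis .
  qed
  have "measure lborel H * ?IV = (\<integral>y. ?IV \<partial>M)"
    by (simp add: mM)
  also have "\<dots> \<le> (\<integral>y. (\<Sum>z\<in>X. ?g z y) \<partial>M)"
    by (rule integral_mono_AE) (use AE_H lower int_g in auto)
  also have "\<dots> = (\<Sum>z\<in>X. ?J z)"
    by (subst Bochner_Integration.integral_sum) (use int_g J in auto)
  also have "\<dots> \<le> (\<Sum>z\<in>X. ?J 0)"
    using pos_def_real_shifted_double_integral_le[OF pd cont absb even finM sets_M]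
    by (intro sum_mono) simp
  also have "\<dots> = real (card X) * (\<integral>y. ?g 0 y \<partial>M)"
    by (simp only: J sum_constant)
  also have "\<dots> \<le> real (card X) * (\<integral>y. ?IU \<partial>M)"
    by (intro mult_left_mono integral_mono_AE) (use AE_H upper int_g[of 0] in auto)
  also have "\<dots> = measure lborel H * (real (card X) * ?IU)"
    by (simp add: mM)
  finally show ?thesis using H(2) by simp
qed

section \<open>The bound for convex bodies\<close>

theorem theorem1:
  fixes U V H K X :: "(real ^ 'n) set"
  assumes "convex_body U" and "zero_symmetric U"
    and "convex_body V" and "zero_symmetric V"
    and "H = (\<lambda>x. (1 / 2) *\<^sub>R x) ` U"
    and "K = V + H"
    and "finite X"
    and "K \<subseteq> H + X"
  shows "C_const U V \<le> ereal (real (card X) * measure lebesgue U / measure lebesgue V)"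
proof -
  have cU: "compact U" "convex U" and iU: "interior U \<noteq> {}" and cV: "compact V"
    using assms(1,3) by (auto simp: convex_body_def)
  have cH: "compact H" unfolding assms(5) by (rule compact_scaling[OF cU(1)])
  have symU: "- x \<in> U" if "x \<in> U" for x
    using that assms(2) unfolding zero_symmetric_def by blast
  have diff: "x - y \<in> U" if "x \<in> H" "y \<in> H" for x y
  proof -
    from that obtain a b where ab: "a \<in> U" "b \<in> U" "x = (1/2) *\<^sub>R a" "y = (1/2) *\<^sub>R b"
      unfolding assms(5) by blast
    have "(1/2) *\<^sub>R a + (1/2) *\<^sub>R (- b) \<in> U"
      by (rule convexD[OF cU(2)]) (use ab symU in auto)
    then show ?thesis using ab by simp
  qed
  have cover: "\<exists>z\<in>X. u + y - z \<in> H" if "u \<in> V" "y \<in> H" for u y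
  proof -
    have "u + y \<in> H + X" using assms(6,8) that by (auto intro: set_plus_intro)
    then obtain h z where "h \<in> H" "z \<in> X" "u + y = h + z" by (auto elim: set_plus_elim)
    then show ?thesis by (intro bexI[of _ z]) auto
  qed
  have mH: "0 < measure lborel H"
  proof -
    obtain x e where e: "e > 0" "cball x e \<subseteq> U"
      using iU mem_interior_cball[of _ U] by blast
    have "cball ((1/2) *\<^sub>R x) (e/2) = (\<lambda>x. (1/2) *\<^sub>R x) ` cball x e"
      by (simp add: cball_scale)
    then have "cball ((1/2) *\<^sub>R x) (e/2) \<subseteq> H"
      using e(2) unfolding assms(5) by blast
    moreover have "emeasure lborel H < \<infinity>" using cH emeasure_compact_finite by blast
    ultimately have "measure lborel (cball ((1/2) *\<^sub>R x) (e/2)) \<le> measure lborel H"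
      using cH by (intro measure_mono_fmeasurable) (auto intro: fmeasurable_compact borel_compact)
    moreover have "0 < measure lborel (cball ((1/2) *\<^sub>R x) (e/2))"
      using e(1) by (intro content_cball_pos) simp
    ultimately show ?thesis by linarith
  qed
  have quotient: "average V f / average U f
      \<le> real (card X) * measure lebesgue U / measure lebesgue V"
    if f: "double_positive_definite f" for f
  proof -
    have cont: "continuous_on UNIV f"
      using f unfolding double_positive_definite_def positive_definite_def
      by (auto dest: continuous_on_Re)
    have nonneg: "\<And>x. 0 \<le> f x" using f by (simp add: double_positive_definite_def)
    have f_meas[measurable]: "f \<in> borel_measurable borel"
      using cont by (rule borel_measurable_continuous_onI)
    have leb: "(\<integral>x\<in>A. f x \<partial>lebesgue) = (\<integral>x\<in>A. f x \<partial>lborel)" if "compact A" for A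
    proof -
      have [measurable]: "A \<in> sets borel" using that by (rule borel_compact)
      show ?thesis unfolding set_lebesgue_integral_def by (rule integral_completion) simp
    qed
    let ?IV = "\<integral>x\<in>V. f x \<partial>lebesgue" and ?IU = "\<integral>x\<in>U. f x \<partial>lebesgue"
    have le: "?IV \<le> real (card X) * ?IU"
      using pos_def_real_integral_le_covering[OF double_positive_definite_imp_pos_def_real[OF f] cont
          double_positive_definite_le_at_0[OF f] double_positive_definite_even[OF f] nonneg
          cH mH cU(1) cV diff cover assms(7)]
      by (simp add: leb cU cV)
    have IU: "0 \<le> ?IU"
      unfolding set_lebesgue_integral_def by (intro integral_nonneg_AE) (simp add: nonneg)
    show ?thesis
    proof (cases "?IU = 0")
      case True
      \<comment> \<open>The quotient is then \<open>0\<close>, by the convention for division by \<open>0\<close>.\<close>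
      then show ?thesis by (simp add: average_def)
    next
      case False
      have "average V f / average U f = measure lebesgue U / measure lebesgue V * (?IV / ?IU)"
        by (simp add: average_def field_simps)
      also have "\<dots> \<le> measure lebesgue U / measure lebesgue V * real (card X)"
        using le IU False by (intro mult_left_mono) (auto simp: divide_le_eq)
      finally show ?thesis by (simp add: mult_ac)
    qed
  qed
  show ?thesis
    unfolding C_const_def by (intro SUP_least) (use quotient in auto)
qed

end
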